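(* Let $T>0$, $S=\{1,2\}$, $\alpha_1,\alpha_2\in(0,\infty)\setminus\{1\}$, $\lambda_1,\lambda_2\ge0$, and $r_i,\mu_i,\sigma_i>0$ for $i\in S$. Then the system of ODEs $$\frac{\alpha_j}{1-\alpha_j}\,g^{i,j}_t(t)=\Big\{\tfrac12\alpha_j\Big(\frac{\mu_i-r_i}{\sigma_i}\Big)^2A_i^2(t)-\Big(\frac{\mu_i-r_i}{\sigma_i}\Big)^2A_i(t)-r_i+\frac{\lambda_i}{1-\alpha_j}\Big[1-\Big(\frac{g^{3-i,j}(t)}{g^{i,j}(t)}\Big)^{\alpha_j}\Big]\Big\}g^{i,j}(t),\quad i,j\in S,$$ with $g^{i,j}(T)=1$ for all $i,j\in S$, where $$A_i(t)=\frac{p(t,i,1)(g^{i,1}(t))^{\frac{\alpha_1}{1-\alpha_1}}+p(t,i,2)(g^{i,2}(t))^{\frac{\alpha_2}{1-\alpha_2}}}{\alpha_1p(t,i,1)(g^{i,1}(t))^{\frac{\alpha_1}{1-\alpha_1}}+\alpha_2p(t,i,2)(g^{i,2}(t))^{\frac{\alpha_2}{1-\alpha_2}}},$$ has a unique global solution on $(-\infty,T]$. Moreover, the solution $\{g^{i,j}\}_{i,j\in S}$ satisfies $g^{i,j}\in C^1((-\infty,T])$ and $g^{i,j}(t)>0$ for all $t\in(-\infty,T]$ and $i,j\in S$.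
   Context: The functions $p(t,i,j)$ are: if $\lambda_1^2+\lambda_2^2\neq0$, $$p(t,1,1)=\tfrac{\lambda_2}{\lambda_1+\lambda_2}+\tfrac{\lambda_1}{\lambda_1+\lambda_2}e^{-(\lambda_1+\lambda_2)(T-t)},\quad p(t,1,2)=\tfrac{\lambda_1}{\lambda_1+\lambda_2}\big[1-e^{-(\lambda_1+\lambda_2)(T-t)}\big],$$ $$p(t,2,1)=\tfrac{\lambda_2}{\lambda_1+\lambda_2}\big[1-e^{-(\lambda_1+\lambda_2)(T-t)}\big],\quad p(t,2,2)=\tfrac{\lambda_1}{\lambda_1+\lambda_2}+\tfrac{\lambda_2}{\lambda_1+\lambda_2}e^{-(\lambda_1+\lambda_2)(T-t)};$$ if $\lambda_1=\lambda_2=0$, $p(t,1,1)=p(t,2,2)=1$ and $p(t,1,2)=p(t,2,1)=0$. A solution of the system on an interval $I\ni T$ is a differentiable map $\vec G=(g^{1,1},g^{2,1},g^{1,2},g^{2,2})^T:I\to(0,\infty)^4$ with $\vec G(T)=(1,1,1,1)^T$ that satisfies the system at every $t\in I$. The subscript $t$ in $g^{i,j}_t$ denotes differentiation in $t$. *)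

theory Defs
  imports "HOL-Analysis.Analysis"
begin

text \<open>
  The index set \<open>S = {1, 2}\<close> is a set of natural numbers, so that \<open>3 - i\<close> is the other index.
  All index-dependent quantities are functions on \<open>nat\<close>; only their values on \<open>S\<close> matter.
\<close>

abbreviation S :: "nat set" where
  "S \<equiv> {1, 2}"

definition p :: "real \<Rightarrow> (nat \<Rightarrow> real) \<Rightarrow> real \<Rightarrow> nat \<Rightarrow> nat \<Rightarrow> real" where
  "p T lam t i j =
    (if (lam 1)\<^sup>2 + (lam 2)\<^sup>2 \<noteq> 0 then
       (if i = 1 \<and> j = 1 then
          lam 2 / (lam 1 + lam 2) + lam 1 / (lam 1 + lam 2) * exp (- (lam 1 + lam 2) * (T - t))
        else if i = 1 \<and> j = 2 then
          lam 1 / (lam 1 + lam 2) * (1 - exp (- (lam 1 + lam 2) * (T - t)))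
        else if i = 2 \<and> j = 1 then
          lam 2 / (lam 1 + lam 2) * (1 - exp (- (lam 1 + lam 2) * (T - t)))
        else
          lam 1 / (lam 1 + lam 2) + lam 2 / (lam 1 + lam 2) * exp (- (lam 1 + lam 2) * (T - t)))
     else (if i = j then 1 else 0))"

definition A ::
  "real \<Rightarrow> (nat \<Rightarrow> real) \<Rightarrow> (nat \<Rightarrow> real) \<Rightarrow> (nat \<Rightarrow> nat \<Rightarrow> real \<Rightarrow> real) \<Rightarrow> nat \<Rightarrow> real \<Rightarrow> real" where
  "A T \<alpha> lam g i t =
    (p T lam t i 1 * g i 1 t powr (\<alpha> 1 / (1 - \<alpha> 1)) +
     p T lam t i 2 * g i 2 t powr (\<alpha> 2 / (1 - \<alpha> 2))) /
    (\<alpha> 1 * p T lam t i 1 * g i 1 t powr (\<alpha> 1 / (1 - \<alpha> 1)) +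
     \<alpha> 2 * p T lam t i 2 * g i 2 t powr (\<alpha> 2 / (1 - \<alpha> 2)))"

definition ode_rhs ::
  "real \<Rightarrow> (nat \<Rightarrow> real) \<Rightarrow> (nat \<Rightarrow> real) \<Rightarrow> (nat \<Rightarrow> real) \<Rightarrow> (nat \<Rightarrow> real) \<Rightarrow> (nat \<Rightarrow> real)
    \<Rightarrow> (nat \<Rightarrow> nat \<Rightarrow> real \<Rightarrow> real) \<Rightarrow> nat \<Rightarrow> nat \<Rightarrow> real \<Rightarrow> real" where
  "ode_rhs T \<alpha> lam r \<mu> \<sigma> g i j t =
    (1 / 2 * \<alpha> j * ((\<mu> i - r i) / \<sigma> i)\<^sup>2 * (A T \<alpha> lam g i t)\<^sup>2
      - ((\<mu> i - r i) / \<sigma> i)\<^sup>2 * A T \<alpha> lam g i t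
      - r i
      + lam i / (1 - \<alpha> j) * (1 - (g (3 - i) j t / g i j t) powr \<alpha> j)) * g i j t"

text \<open>The derivative is taken within \<open>I\<close>, hence is one-sided at an end point of \<open>I\<close> such as \<open>T\<close>.\<close>

definition is_solution_on ::
  "real set \<Rightarrow> real \<Rightarrow> (nat \<Rightarrow> real) \<Rightarrow> (nat \<Rightarrow> real) \<Rightarrow> (nat \<Rightarrow> real) \<Rightarrow> (nat \<Rightarrow> real) \<Rightarrow> (nat \<Rightarrow> real)
    \<Rightarrow> (nat \<Rightarrow> nat \<Rightarrow> real \<Rightarrow> real) \<Rightarrow> bool" where
  "is_solution_on I T \<alpha> lam r \<mu> \<sigma> g \<longleftrightarrow>
    is_interval I \<and> T \<in> I \<and>
    (\<forall>i\<in>S. \<forall>j\<in>S.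
      g i j T = 1 \<and>
      (\<forall>t\<in>I. g i j t > 0 \<and>
        (\<exists>d. (g i j has_real_derivative d) (at t within I) \<and>
             \<alpha> j / (1 - \<alpha> j) * d = ode_rhs T \<alpha> lam r \<mu> \<sigma> g i j t)))"

text \<open>
  The library's \<open>C1_differentiable_on\<close> requires two-sided derivatives, so it does not express
  \<open>C\<^sup>1\<close> on an interval that contains an end point.
\<close>

definition C1_within :: "(real \<Rightarrow> real) \<Rightarrow> real set \<Rightarrow> bool" where
  "C1_within f I \<longleftrightarrow>
    (\<exists>f'. (\<forall>t\<in>I. (f has_real_derivative f' t) (at t within I)) \<and> continuous_on I f')"

end

theory Submission
  imports Defs
begin

text \<open>
  In the variables \<open>u i j s = \<alpha> j / (1 - \<alpha> j) * ln (g i j (T - s))\<close> the system reads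
  \<open>u i j' = drift + lam i * \<phi> j (u (3 - i) j - u i j)\<close>, where the drift depends on \<open>u\<close> only through
  \<open>A\<close> and is therefore bounded, by \<open>B\<close> say, and globally Lipschitz. The coupling \<open>\<phi> j\<close> has the sign
  of its argument, so it pulls \<open>u 1 j\<close> and \<open>u 2 j\<close> together: every solution satisfies
  \<open>\<bar>u 1 j - u 2 j\<bar> \<le> 2 * B * s\<close>. Truncating the argument of \<open>\<phi> j\<close> at \<open>2 * B * s\<close> thus does not change
  the solutions, and makes the field Lipschitz on bounded time intervals, so that
  Picard's theorem applies globally.
\<close>

section \<open>Global existence and uniqueness for Lipschitz fields\<close>

lemma picard_Icc:
  fixes F :: "real \<Rightarrow> 'a::banach \<Rightarrow> 'a"
  assumes "0 \<le> b"
    and cont: "continuous_on ({0..b} \<times> UNIV) (\<lambda>(s, x). F s x)"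
    and lip: "\<And>s x y. s \<in> {0..b} \<Longrightarrow> norm (F s x - F s y) \<le> L * norm (x - y)"
  shows "\<exists>u. u 0 = init \<and>
    (\<forall>s\<in>{0..b}. (u has_vector_derivative F s (u s)) (at s within {0..b}))"
proof -
  \<comment> \<open>The weight \<open>exp (- K * s)\<close> makes the Picard operator a contraction on all of \<open>{0..b}\<close> at once;
    composing with the projection \<open>c\<close> onto \<open>{0..b}\<close> turns it into a map on bounded continuous functions.\<close>
  define K where "K = 2 * (\<bar>L\<bar> + 1)"
  have K: "K > 0" "\<bar>L\<bar> \<le> K / 2" by (auto simp: K_def)
  define c where "c = (\<lambda>s::real. max 0 (min b s))"
  have c: "c s \<in> {0..b}" for s using \<open>0 \<le> b\<close> by (auto simp: c_def)
  have c_id: "c s = s" if "s \<in> {0..b}" for s using that by (auto simp: c_def)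
  define G where "G = (\<lambda>v \<tau>. F \<tau> (exp (K * \<tau>) *\<^sub>R apply_bcontfun v \<tau>))"
  have G_cont: "continuous_on {0..b} (G v)" for v
    unfolding G_def
    by (rule continuous_on_compose2[OF cont, where f = "\<lambda>\<tau>. (\<tau>, exp (K * \<tau>) *\<^sub>R apply_bcontfun v \<tau>)", simplified])
      (auto intro!: continuous_intros)
  have G_int: "G v integrable_on {0..c s}" for v s
    using c[of s] by (intro integrable_continuous_real continuous_on_subset[OF G_cont]) auto
  define P0 where "P0 = (\<lambda>v s. exp (- K * s) *\<^sub>R (init + integral {0..s} (G v)))"
  have P0_cont: "continuous_on {0..b} (P0 v)" for v
    unfolding P0_def
    by (intro continuous_intros indefinite_integral_continuous_1 integrable_continuous_real G_cont)
  have in_bcont: "(\<lambda>s. P0 v (c s)) \<in> bcontfun" for v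
  proof -
    have "continuous_on UNIV (\<lambda>s. P0 v (c s))"
      by (rule continuous_on_compose2[OF P0_cont]) (use c in \<open>auto simp: c_def intro!: continuous_intros\<close>)
    moreover have "bounded (P0 v ` {0..b})"
      using compact_continuous_image[OF P0_cont] by (simp add: compact_imp_bounded)
    then have "bounded (range (\<lambda>s. P0 v (c s)))"
      by (rule bounded_subset) (use c in auto)
    ultimately show ?thesis by (simp add: bcontfun_def)
  qed
  define P where "P = (\<lambda>v. Bcontfun (\<lambda>s. P0 v (c s)))"
  have P: "apply_bcontfun (P v) s = P0 v (c s)" for v s
    by (simp add: P_def Bcontfun_inverse in_bcont)
  have "dist (P v) (P w) \<le> 1/2 * dist v w" for v w
  proof (rule dist_bound)
    fix s
    define d where "d = dist v w"
    have d: "norm (apply_bcontfun v \<tau> - apply_bcontfun w \<tau>) \<le> d" for \<tau>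
      using dist_bounded[of v \<tau> w] by (simp add: d_def dist_norm)
    have d0: "d \<ge> 0" by (simp add: d_def)
    \<comment> \<open>\<open>K / 2\<close> dominates the Lipschitz constant and integrating
      \<open>exp (K * \<tau>)\<close> gains a factor \<open>1 / K\<close>; this is the source of the
      contraction factor 1/2.\<close>
    have FTC: "((\<lambda>\<tau>. K / 2 * d * exp (K * \<tau>)) has_integral (d / 2 * exp (K * c s) - d / 2 * exp (K * 0))) {0..c s}"
      using c[of s] K(1)
      by (intro fundamental_theorem_of_calculus)
        (auto intro!: derivative_eq_intros simp: has_real_derivative_iff_has_vector_derivative[symmetric])
    have "norm (integral {0..c s} (\<lambda>\<tau>. G v \<tau> - G w \<tau>)) \<le> integral {0..c s} (\<lambda>\<tau>. K / 2 * d * exp (K * \<tau>))"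
    proof (rule integral_norm_bound_integral)
      fix \<tau> assume "\<tau> \<in> {0..c s}"
      then have "\<tau> \<in> {0..b}" using c[of s] by auto
      then have "norm (G v \<tau> - G w \<tau>) \<le> L * norm (exp (K * \<tau>) *\<^sub>R apply_bcontfun v \<tau> - exp (K * \<tau>) *\<^sub>R apply_bcontfun w \<tau>)"
        unfolding G_def by (rule lip)
      also have "\<dots> = L * (exp (K * \<tau>) * norm (apply_bcontfun v \<tau> - apply_bcontfun w \<tau>))"
        by (simp flip: scaleR_diff_right)
      also have "\<dots> \<le> K / 2 * (exp (K * \<tau>) * d)"
        using K d[of \<tau>] by (intro mult_mono) auto
      finally show "norm (G v \<tau> - G w \<tau>) \<le> K / 2 * d * exp (K * \<tau>)" by (simp add: mult_ac)
    qed (use FTC in \<open>auto intro!: integrable_diff G_int\<close>)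
    also have "\<dots> = d / 2 * exp (K * c s) - d / 2"
      using integral_unique[OF FTC] by simp
    also have "\<dots> \<le> d / 2 * exp (K * c s)"
      using d0 by simp
    finally have *: "norm (integral {0..c s} (G v) - integral {0..c s} (G w)) \<le> d / 2 * exp (K * c s)"
      by (simp add: integral_diff G_int)
    have "dist (P v s) (P w s) = exp (- K * c s) * norm (integral {0..c s} (G v) - integral {0..c s} (G w))"
      by (simp add: P P0_def dist_norm flip: scaleR_diff_right)
    also have "\<dots> \<le> exp (- K * c s) * (d / 2 * exp (K * c s))"
      by (intro mult_left_mono *) auto
    also have "\<dots> = 1/2 * d" by (simp add: exp_minus field_simps)
    finally show "dist (P v s) (P w s) \<le> 1/2 * dist v w" by (simp add: d_def)
  qed
  then have "\<exists>!v. P v = v"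
    by (intro banach_fix_type[where c = "1/2"]) auto
  then obtain v where v: "P v = v" by blast
  \<comment> \<open>The fixed point \<open>v\<close> is the solution damped by
    \<open>exp (- K * s)\<close>. Taking the undamped integral as \<open>u\<close> makes its
    derivative available from the fundamental theorem of calculus.\<close>
  define u where "u = (\<lambda>s. init + integral {0..s} (G v))"
  have u: "exp (K * s) *\<^sub>R apply_bcontfun v s = u s" if "s \<in> {0..b}" for s
    by (subst v[symmetric]) (simp add: P P0_def c_id[OF that] u_def exp_minus)
  have "u 0 = init" by (simp add: u_def)
  moreover have "(u has_vector_derivative F s (u s)) (at s within {0..b})" if "s \<in> {0..b}" for s
  proof -
    have "(u has_vector_derivative (0 + G v s)) (at s within {0..b})"
      unfolding u_def using that
      by (intro derivative_intros integral_has_vector_derivative G_cont)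
    then show ?thesis using u[OF that] by (simp add: G_def)
  qed
  ultimately show ?thesis by blast
qed

text \<open>Gronwall's argument: by Cauchy-Schwarz the squared distance of two solutions grows at
  rate at most \<open>2 * L\<close>, so multiplied by \<open>exp (- 2 * L * s)\<close> it is
  nonincreasing, and it starts at 0.\<close>

lemma ode_unique_Icc:
  fixes F :: "real \<Rightarrow> 'a::real_inner \<Rightarrow> 'a"
  assumes lip: "\<And>s x y. s \<in> {0..b} \<Longrightarrow> norm (F s x - F s y) \<le> L * norm (x - y)"
    and u: "\<And>s. s \<in> {0..b} \<Longrightarrow> (u has_vector_derivative F s (u s)) (at s within {0..b})"
    and v: "\<And>s. s \<in> {0..b} \<Longrightarrow> (v has_vector_derivative F s (v s)) (at s within {0..b})"
    and "u 0 = v 0" "t \<in> {0..b}"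
  shows "u t = v t"
proof -
  define w where "w = (\<lambda>s. exp (- 2 * L * s) * ((u s - v s) \<bullet> (u s - v s)))"
  define w' where "w' = (\<lambda>s. exp (- 2 * L * s) *
    (2 * ((u s - v s) \<bullet> (F s (u s) - F s (v s))) - 2 * L * ((u s - v s) \<bullet> (u s - v s))))"
  have w: "(w has_real_derivative w' s) (at s within {0..b})" if "s \<in> {0..b}" for s
  proof -
    have n: "((\<lambda>s. (u s - v s) \<bullet> (u s - v s)) has_real_derivative
        (2 * ((u s - v s) \<bullet> (F s (u s) - F s (v s))))) (at s within {0..b})"
      unfolding has_real_derivative_iff_has_vector_derivative
      using bounded_bilinear.has_vector_derivative[OF bounded_bilinear_inner
          has_vector_derivative_diff[OF u v, OF that that] has_vector_derivative_diff[OF u v, OF that that]]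
      by (simp add: inner_commute)
    have e: "((\<lambda>s. exp (- 2 * L * s)) has_real_derivative exp (- 2 * L * s) * (- 2 * L)) (at s within {0..b})"
      by (auto intro!: derivative_eq_intros)
    show ?thesis unfolding w_def w'_def
      by (rule DERIV_cong[OF DERIV_mult[OF e n]]) (simp add: algebra_simps)
  qed
  have w': "w' s \<le> 0" if "s \<in> {0..b}" for s
  proof -
    have "(u s - v s) \<bullet> (F s (u s) - F s (v s)) \<le> norm (u s - v s) * (L * norm (u s - v s))"
      by (rule order_trans[OF norm_cauchy_schwarz]) (intro mult_left_mono lip that norm_ge_zero)
    also have "\<dots> = L * ((u s - v s) \<bullet> (u s - v s))"
      by (simp add: dot_square_norm power2_eq_square)
    finally show ?thesis by (auto simp: w'_def mult_le_0_iff)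
  qed
  have "w t \<le> w 0"
  proof (rule DERIV_nonpos_imp_decreasing_open[where f = w])
    show "continuous_on {0..t} w"
      by (rule continuous_on_subset[OF DERIV_continuous_on[OF w]]) (use assms(5) in auto)
    fix s assume "0 < s" "s < t"
    then have "s \<in> {0..b}" "at s within {0..b} = at s"
      using assms(5) by (auto intro!: at_within_Icc_at)
    then show "\<exists>y. (w has_real_derivative y) (at s) \<and> y \<le> 0"
      using w[of s] w'[of s] by auto
  qed (use assms(5) in auto)
  also have "w 0 = 0" by (simp add: w_def \<open>u 0 = v 0\<close>)
  finally have "(u t - v t) \<bullet> (u t - v t) \<le> 0"
    by (simp add: w_def mult_le_0_iff)
  then show ?thesis by (metis inner_gt_zero_iff not_less right_minus_eq)
qed

text \<open>The Lipschitz constant may grow with the time horizon. Solutions on the intervals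
  \<open>{0..real n}\<close> agree by uniqueness and are glued together.\<close>

lemma picard_global:
  fixes F :: "real \<Rightarrow> 'a::euclidean_space \<Rightarrow> 'a"
  assumes cont: "continuous_on ({0..} \<times> UNIV) (\<lambda>(s, x). F s x)"
    and lip: "\<And>s b x y. 0 \<le> s \<Longrightarrow> s \<le> b \<Longrightarrow> norm (F s x - F s y) \<le> L b * norm (x - y)"
  shows "\<exists>u. u 0 = init \<and>
    (\<forall>s\<ge>0. (u has_vector_derivative F s (u s)) (at s within {0..}))"
proof -
  have "\<forall>n. \<exists>u. u 0 = init \<and> (\<forall>s\<in>{0..real n}. (u has_vector_derivative F s (u s)) (at s within {0..real n}))"
  proof
    show "\<exists>u. u 0 = init \<and> (\<forall>s\<in>{0..real n}. (u has_vector_derivative F s (u s)) (at s within {0..real n}))" for n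
      by (rule picard_Icc[where L = "L (real n)"]) (auto intro: lip continuous_on_subset[OF cont])
  qed
  then obtain U where U0: "\<And>n. U n 0 = init"
    and U: "\<And>n s. s \<in> {0..real n} \<Longrightarrow> (U n has_vector_derivative F s (U n s)) (at s within {0..real n})"
    by metis
  have U_eq: "U m t = U n t" if "m \<le> n" "t \<in> {0..real m}" for m n t
  proof (rule ode_unique_Icc[where F = F and L = "L (real m)" and b = "real m"])
    fix s assume "s \<in> {0..real m}"
    then have "(U n has_vector_derivative F s (U n s)) (at s within {0..real n})"
      using that by (intro U) auto
    then show "(U n has_vector_derivative F s (U n s)) (at s within {0..real m})"
      by (rule has_vector_derivative_within_subset) (use that in auto)
  qed (use that in \<open>auto intro: lip U simp: U0\<close>)
  define u where "u = (\<lambda>s. U (nat \<lceil>s\<rceil>) s)"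
  have u_eq: "u s = U n s" if "0 \<le> s" "s \<le> real n" for s n
    unfolding u_def by (rule U_eq) (use that in \<open>auto simp: nat_le_iff ceiling_le_iff\<close>)
  have "(u has_vector_derivative F s (u s)) (at s within {0..})" if "s \<ge> 0" for s
  proof -
    \<comment> \<open>The extra 1 puts \<open>s\<close> strictly below \<open>real n\<close>, so the
      right end of \<open>{0..real n}\<close> is invisible near \<open>s\<close> and the derivative
      within \<open>{0..real n}\<close> is the one within \<open>{0..}\<close>.\<close>
    define n where "n = nat \<lceil>s\<rceil> + 1"
    have n: "s < real n" unfolding n_def by linarith
    have "(U n has_vector_derivative F s (u s)) (at s within {0..real n})"
      using U[of s n] that n by (simp add: u_eq[of s n])
    then have "(u has_vector_derivative F s (u s)) (at s within {0..real n})"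
      by (rule has_vector_derivative_transform[rotated 2]) (use that n in \<open>auto simp: u_eq\<close>)
    moreover have "at s within {0..real n} = at s within {0..}"
      by (rule at_within_nhd[where S = "{..<real n}"]) (use n in auto)
    ultimately show ?thesis by simp
  qed
  moreover have "u 0 = init" by (simp add: u_def U0)
  ultimately show ?thesis by blast
qed

text \<open>A barrier argument: the derivative need only be controlled where \<open>D\<close> lies
  above the line, because a violation at \<open>t\<close> can be traced back to the last time at
  which \<open>D\<close> was not above it.\<close>

lemma le_linear_if_deriv_le:
  fixes D D' :: "real \<Rightarrow> real"
  assumes "D 0 = 0"
    and D: "\<And>s. s \<ge> 0 \<Longrightarrow> (D has_real_derivative D' s) (at s within {0..})"
    and le: "\<And>s. s \<ge> 0 \<Longrightarrow> D s > C * s \<Longrightarrow> D' s \<le> C"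
    and "t \<ge> 0"
  shows "D t \<le> C * t"
proof (rule ccontr)
  define E where "E = (\<lambda>s. D s - C * s)"
  assume "\<not> D t \<le> C * t"
  then have Et: "E t > 0" by (simp add: E_def)
  have E: "(E has_real_derivative D' s - C) (at s within {0..})" if "s \<ge> 0" for s
    unfolding E_def using D[OF that] by (auto intro!: derivative_eq_intros)
  have cont: "continuous_on {0..t} E"
    by (rule continuous_on_subset[OF DERIV_continuous_on[OF E]]) auto
  \<comment> \<open>\<open>Z\<close> collects the times with \<open>E s \<le> 0\<close>. After its
    last element \<open>z\<close> the function \<open>E\<close> is positive, hence nonincreasing up
    to \<open>t\<close>, which contradicts \<open>E t > 0\<close>.\<close>
  define Z where "Z = {0..t} \<inter> E -` {..0}"
  have "compact Z"
    unfolding Z_def compact_eq_bounded_closed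
    by (auto intro: continuous_closed_preimage[OF cont])
  moreover have "0 \<in> Z" using \<open>t \<ge> 0\<close> \<open>D 0 = 0\<close> by (simp add: Z_def E_def)
  ultimately obtain z where z: "z \<in> Z" "\<And>s. s \<in> Z \<Longrightarrow> s \<le> z"
    using compact_attains_sup[of Z] by blast
  have "E t \<le> E z"
  proof (rule DERIV_nonpos_imp_decreasing_open[where f = E])
    show "z \<le> t" using z by (auto simp: Z_def)
    show "continuous_on {z..t} E"
      by (rule continuous_on_subset[OF cont]) (use z in \<open>auto simp: Z_def\<close>)
    fix s assume s: "z < s" "s < t"
    then have "s > 0" using z by (auto simp: Z_def)
    have "s \<notin> Z" using z(2)[of s] s by auto
    then have "E s > 0" using s \<open>s > 0\<close> by (auto simp: Z_def)
    then have "D' s - C \<le> 0" using le[of s] \<open>s > 0\<close> by (simp add: E_def)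
    moreover have "at s within {0..} = at s"
      by (rule at_within_interior) (use \<open>s > 0\<close> in auto)
    ultimately show "\<exists>y. (E has_real_derivative y) (at s) \<and> y \<le> 0"
      using E[of s] \<open>s > 0\<close> by auto
  qed
  with z Et show False by (auto simp: Z_def)
qed

section \<open>Estimates for the nonlinearities\<close>

text \<open>The tangent inequality \<open>1 + (y - x) \<le> exp (y - x)\<close> multiplied by
  \<open>exp x\<close>; the sum of both exponentials makes the bound symmetric.\<close>

lemma abs_exp_diff_le: "\<bar>exp x - exp y\<bar> \<le> \<bar>x - y\<bar> * (exp x + exp y)" for x y :: real
proof -
  have *: "exp x - exp y \<le> (x - y) * exp x" for x y :: real
    using mult_left_mono[OF exp_ge_add_one_self[of "y - x"], of "exp x"]
    by (simp add: exp_diff algebra_simps)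
  have "(x - y) * exp x \<le> \<bar>x - y\<bar> * (exp x + exp y)" "(y - x) * exp y \<le> \<bar>x - y\<bar> * (exp x + exp y)"
    by (intro mult_mono; simp)+
  with *[of x y] *[of y x] show ?thesis by linarith
qed

definition trunc :: "real \<Rightarrow> real \<Rightarrow> real" where
  "trunc R x = max (- R) (min R x)"

lemma trunc_eq: "\<bar>x\<bar> \<le> R \<Longrightarrow> trunc R x = x"
  by (auto simp: trunc_def)

lemma abs_trunc_le: "0 \<le> R \<Longrightarrow> \<bar>trunc R x\<bar> \<le> R"
  by (auto simp: trunc_def)

lemma trunc_lipschitz: "\<bar>trunc R x - trunc R y\<bar> \<le> \<bar>x - y\<bar>"
  by (auto simp: trunc_def max_def min_def)

text \<open>The shape of the quotient \<open>A\<close>: the reciprocal of the mean of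
  \<open>a\<close> and \<open>b\<close> with weights \<open>X\<close> and \<open>Y\<close>. It is
  bounded as soon as \<open>a\<close> and \<open>b\<close> are bounded away from 0.\<close>

definition mix_ratio :: "real \<Rightarrow> real \<Rightarrow> real \<Rightarrow> real \<Rightarrow> real" where
  "mix_ratio a b X Y = (X + Y) / (a * X + b * Y)"

lemma mix_ratio_denom_ge:
  fixes m a b X Y :: real
  assumes "m \<le> a" "m \<le> b" "0 \<le> X" "0 \<le> Y"
  shows "m * (X + Y) \<le> a * X + b * Y"
  using mult_right_mono[OF assms(1,3)] mult_right_mono[OF assms(2,4)] by (simp add: algebra_simps)

lemma mix_ratio_bounds:
  assumes "0 < m" "m \<le> a" "m \<le> b" "0 \<le> X" "0 \<le> Y" "0 < X + Y"
  shows "0 \<le> mix_ratio a b X Y" "mix_ratio a b X Y \<le> 1 / m"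
proof -
  have d: "m * (X + Y) \<le> a * X + b * Y" "0 < m * (X + Y)"
    using assms by (auto intro: mix_ratio_denom_ge)
  then show "0 \<le> mix_ratio a b X Y" using assms by (auto simp: mix_ratio_def)
  have "mix_ratio a b X Y \<le> (X + Y) / (m * (X + Y))"
    unfolding mix_ratio_def using d less_le_trans[OF d(2) d(1)] assms
    by (intro divide_left_mono mult_pos_pos) auto
  also have "\<dots> = 1 / m" using assms by simp
  finally show "mix_ratio a b X Y \<le> 1 / m" .
qed

text \<open>The bound is global although exponentials occur: the numerator of the difference of the
  quotients is at most a multiple of \<open>(X + Y) * (X' + Y')\<close>, and the denominator is at
  least \<open>m\<^sup>2\<close> times this product.\<close>

lemma mix_ratio_exp_lipschitz:
  assumes m: "0 < m" "m \<le> a" "m \<le> b" and q: "0 \<le> q" "0 \<le> q'" "0 < q + q'"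
  shows "\<bar>mix_ratio a b (q * exp x) (q' * exp y) - mix_ratio a b (q * exp x') (q' * exp y')\<bar>
    \<le> \<bar>b - a\<bar> / m\<^sup>2 * (\<bar>x - x'\<bar> + \<bar>y - y'\<bar>)"
proof -
  define X Y X' Y' where XY: "X = q * exp x" "Y = q' * exp y" "X' = q * exp x'" "Y' = q' * exp y'"
  have nn: "0 \<le> X" "0 \<le> Y" "0 \<le> X'" "0 \<le> Y'" using q by (auto simp: XY)
  have "0 < q \<or> 0 < q'" using q by linarith
  then have pos: "0 < X + Y" "0 < X' + Y'"
    using q by (auto simp: XY intro: add_pos_nonneg add_nonneg_pos)
  define N where "N = a * X + b * Y"
  define N' where "N' = a * X' + b * Y'"
  have N: "m * (X + Y) \<le> N" "m * (X' + Y') \<le> N'"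
    unfolding N_def N'_def by (intro mix_ratio_denom_ge m nn)+
  then have Npos: "0 < N" "0 < N'"
    using m(1) pos by (meson less_le_trans mult_pos_pos)+
  have "mix_ratio a b X Y - mix_ratio a b X' Y' = ((X + Y) * N' - (X' + Y') * N) / (N * N')"
    using Npos by (simp add: mix_ratio_def diff_frac_eq flip: N_def N'_def)
  \<comment> \<open>The terms with \<open>X * X'\<close> and \<open>Y * Y'\<close> cancel. What
    remains is a difference of two exponentials, at \<open>x + y'\<close> and at
    \<open>x' + y\<close>.\<close>
  also have "(X + Y) * N' - (X' + Y') * N = (b - a) * (X * Y' - X' * Y)"
    by (simp add: N_def N'_def algebra_simps)
  finally have "\<bar>mix_ratio a b X Y - mix_ratio a b X' Y'\<bar> = \<bar>b - a\<bar> * \<bar>X * Y' - X' * Y\<bar> / (N * N')"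
    using Npos by (simp add: abs_mult)
  also have "\<dots> \<le> \<bar>b - a\<bar> * ((\<bar>x - x'\<bar> + \<bar>y - y'\<bar>) * ((X + Y) * (X' + Y'))) / (m * (X + Y) * (m * (X' + Y')))"
  proof (rule frac_le)
    have "\<bar>X * Y' - X' * Y\<bar> = \<bar>q * q' * (exp (x + y') - exp (x' + y))\<bar>"
      by (simp add: XY exp_add algebra_simps)
    also have "\<dots> = q * q' * \<bar>exp (x + y') - exp (x' + y)\<bar>"
      using q by (simp add: abs_mult)
    also have "\<dots> \<le> q * q' * (\<bar>(x + y') - (x' + y)\<bar> * (exp (x + y') + exp (x' + y)))"
      using q by (intro mult_left_mono abs_exp_diff_le) auto
    also have "\<dots> = \<bar>(x + y') - (x' + y)\<bar> * (X * Y' + X' * Y)"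
      by (simp add: XY exp_add algebra_simps)
    also have "\<dots> \<le> (\<bar>x - x'\<bar> + \<bar>y - y'\<bar>) * ((X + Y) * (X' + Y'))"
    proof (rule mult_mono)
      show "X * Y' + X' * Y \<le> (X + Y) * (X' + Y')"
        using mult_nonneg_nonneg[OF nn(1,3)] mult_nonneg_nonneg[OF nn(2,4)] by (simp add: algebra_simps)
    qed (use nn in auto)
    finally show "\<bar>b - a\<bar> * \<bar>X * Y' - X' * Y\<bar> \<le> \<bar>b - a\<bar> * ((\<bar>x - x'\<bar> + \<bar>y - y'\<bar>) * ((X + Y) * (X' + Y')))"
      by (rule mult_left_mono) simp
    show "m * (X + Y) * (m * (X' + Y')) \<le> N * N'"
      by (rule mult_mono) (use N Npos m(1) pos in auto)
    show "0 < m * (X + Y) * (m * (X' + Y'))"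
      using m(1) pos by simp
    show "0 \<le> \<bar>b - a\<bar> * ((\<bar>x - x'\<bar> + \<bar>y - y'\<bar>) * ((X + Y) * (X' + Y')))"
      using pos by simp
  qed
  also have "\<dots> = \<bar>b - a\<bar> / m\<^sup>2 * (\<bar>x - x'\<bar> + \<bar>y - y'\<bar>)"
    using pos m(1) by (simp add: power2_eq_square)
  finally show ?thesis by (simp add: XY)
qed

section \<open>Transition probabilities of the two-state Markov chain\<close>

lemma p_nonneg:
  assumes "lam 1 \<ge> 0" "lam 2 \<ge> 0" "t \<le> T"
  shows "p T lam t i j \<ge> 0"
proof -
  define e where "e = exp (- (lam 1 + lam 2) * (T - t))"
  have "- (lam 1 + lam 2) * (T - t) \<le> 0"
    using assms by (intro mult_nonpos_nonneg) auto
  then have e: "0 \<le> e" "0 \<le> 1 - e" by (auto simp: e_def)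
  have "0 \<le> lam 1 / (lam 1 + lam 2)" "0 \<le> lam 2 / (lam 1 + lam 2)"
    using assms by auto
  then show ?thesis
    unfolding p_def e_def[symmetric] using e
    by (simp only: split: if_split) (intro conjI impI add_nonneg_nonneg mult_nonneg_nonneg; simp)
qed

lemma p_sum:
  assumes "lam 1 \<ge> 0" "lam 2 \<ge> 0" "i \<in> S"
  shows "p T lam t i 1 + p T lam t i 2 = 1"
proof (cases "lam 1 + lam 2 = 0")
  case True
  then have "lam 1 = 0" "lam 2 = 0" using assms by auto
  then show ?thesis using assms(3) by (auto simp: p_def)
next
  case False
  then have "(lam 1)\<^sup>2 + (lam 2)\<^sup>2 \<noteq> 0" by auto
  moreover define c d where "c = lam 1 / (lam 1 + lam 2)" and "d = lam 2 / (lam 1 + lam 2)"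
  moreover have "c + d = 1"
    using False by (simp add: c_def d_def flip: add_divide_distrib)
  ultimately show ?thesis
    using assms(3) by (auto simp: p_def algebra_simps simp flip: c_def d_def simp del: One_nat_def)
qed

lemma continuous_on_p [continuous_intros]:
  assumes "continuous_on X f"
  shows "continuous_on X (\<lambda>s. p T lam (f s) i j)"
proof (cases "(lam 1)\<^sup>2 + (lam 2)\<^sup>2 = 0")
  case True
  then show ?thesis by (simp add: p_def)
next
  case False
  then show ?thesis
    using assms by (cases "i = 1"; cases "i = 2"; cases "j = 1"; cases "j = 2")
      (auto simp: p_def divide_inverse simp del: One_nat_def sum_power2_eq_zero_iff
        intro!: continuous_on_add continuous_on_diff continuous_on_mult continuous_on_exp continuous_on_const)
qed

section \<open>The system in logarithmic variables\<close>

locale ode_system =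
  fixes T :: real and \<alpha> lam r \<mu> \<sigma> :: "nat \<Rightarrow> real"
  assumes \<alpha>_pos: "j \<in> S \<Longrightarrow> 0 < \<alpha> j" and \<alpha>_neq_1: "j \<in> S \<Longrightarrow> \<alpha> j \<noteq> 1"
    and lam_nonneg: "i \<in> S \<Longrightarrow> 0 \<le> lam i"
    and r_pos: "i \<in> S \<Longrightarrow> 0 < r i"
begin

definition \<kappa> :: "nat \<Rightarrow> real" where
  "\<kappa> i = ((\<mu> i - r i) / \<sigma> i)\<^sup>2"

text \<open>The exponent of \<open>g i j\<close> in \<open>A\<close>, so that \<open>exp\<close> of
  the logarithmic variable is exactly the power occurring there. It is negative when
  \<open>\<alpha> j > 1\<close>.\<close>

definition \<beta> :: "nat \<Rightarrow> real" where
  "\<beta> j = \<alpha> j / (1 - \<alpha> j)"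

definition avg :: "real \<Rightarrow> nat \<Rightarrow> (nat \<Rightarrow> real) \<Rightarrow> real" where
  "avg s i U = mix_ratio (\<alpha> 1) (\<alpha> 2) (p T lam (T - s) i 1 * exp (U 1)) (p T lam (T - s) i 2 * exp (U 2))"

text \<open>The signs are opposite to those in \<open>ode_rhs\<close> because
  \<open>s = T - t\<close> reverses time.\<close>

definition drift :: "nat \<Rightarrow> nat \<Rightarrow> real \<Rightarrow> real" where
  "drift i j a = \<kappa> i * a - 1 / 2 * \<alpha> j * \<kappa> i * a\<^sup>2 + r i"

text \<open>Because \<open>(1 - \<alpha> j) * \<beta> j = \<alpha> j\<close>, the power
  \<open>(g (3 - i) j t / g i j t) powr \<alpha> j\<close> equals
  \<open>exp ((1 - \<alpha> j) * x)\<close>, where \<open>x\<close> is the difference of the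
  logarithmic variables.\<close>

definition \<phi> :: "nat \<Rightarrow> real \<Rightarrow> real" where
  "\<phi> j x = (exp ((1 - \<alpha> j) * x) - 1) / (1 - \<alpha> j)"

text \<open>The system in the variables \<open>U i j s = \<beta> j * ln (g i j (T - s))\<close> is the case \<open>c = (\<lambda>x. x)\<close>.\<close>

definition field :: "(real \<Rightarrow> real) \<Rightarrow> real \<Rightarrow> (nat \<Rightarrow> nat \<Rightarrow> real) \<Rightarrow> nat \<Rightarrow> nat \<Rightarrow> real" where
  "field c s U i j = drift i j (avg s i (U i)) + lam i * \<phi> j (c (U (3 - i) j - U i j))"

lemma S_other: "i \<in> S \<Longrightarrow> 3 - i \<in> S" "i \<in> S \<Longrightarrow> 3 - (3 - i) = i"
  by auto

definition m :: real where "m = min (\<alpha> 1) (\<alpha> 2)"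

lemma m: "0 < m" "m \<le> \<alpha> 1" "m \<le> \<alpha> 2"
  using \<alpha>_pos[of 1] \<alpha>_pos[of 2] by (auto simp: m_def)

lemma \<kappa>_nonneg: "0 \<le> \<kappa> i"
  by (simp add: \<kappa>_def)

lemma p_weights:
  assumes "i \<in> S" "0 \<le> s"
  shows "0 \<le> p T lam (T - s) i 1" "0 \<le> p T lam (T - s) i 2"
    "0 < p T lam (T - s) i 1 + p T lam (T - s) i 2"
  using p_nonneg[of lam "T - s" T i] p_sum[of lam i T "T - s"] assms lam_nonneg[of 1] lam_nonneg[of 2]
  by auto

text \<open>At \<open>s = 0\<close> one of the weights vanishes, so positivity comes from the sum of
  the weights and not from each of them.\<close>

lemma p_exp_sum_pos:
  assumes "i \<in> S" "0 \<le> s"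
  shows "0 < p T lam (T - s) i 1 * exp x + p T lam (T - s) i 2 * exp y"
proof -
  have "0 < p T lam (T - s) i 1 \<or> 0 < p T lam (T - s) i 2"
    using p_weights[OF assms] by linarith
  then show ?thesis
    using p_weights[OF assms] by (auto intro: add_pos_nonneg add_nonneg_pos)
qed

lemma avg_bounds:
  assumes "i \<in> S" "0 \<le> s"
  shows "0 \<le> avg s i U" "avg s i U \<le> 1 / m"
  unfolding avg_def using p_weights[OF assms]
  by (intro mix_ratio_bounds[of m] m p_exp_sum_pos assms; simp)+

lemma avg_lipschitz:
  assumes "i \<in> S" "0 \<le> s"
  shows "\<bar>avg s i U - avg s i V\<bar> \<le> \<bar>\<alpha> 2 - \<alpha> 1\<bar> / m\<^sup>2 * (\<bar>U 1 - V 1\<bar> + \<bar>U 2 - V 2\<bar>)"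
  unfolding avg_def using p_weights[OF assms] m by (intro mix_ratio_exp_lipschitz) auto

text \<open>A quadratic polynomial is Lipschitz only on bounded sets; the bound \<open>1 / m\<close>
  on \<open>avg\<close> supplies the radius \<open>R\<close>.\<close>

lemma drift_lipschitz:
  assumes "j \<in> S" "\<bar>a\<bar> \<le> R" "\<bar>b\<bar> \<le> R"
  shows "\<bar>drift i j a - drift i j b\<bar> \<le> \<kappa> i * (1 + \<alpha> j * R) * \<bar>a - b\<bar>"
proof -
  have *: "\<bar>1 - 1 / 2 * \<alpha> j * (a + b)\<bar> \<le> 1 + \<alpha> j * R"
  proof -
    have "\<bar>1 - 1 / 2 * \<alpha> j * (a + b)\<bar> \<le> 1 + \<alpha> j * \<bar>(a + b) / 2\<bar>"
      using abs_triangle_ineq4[of 1 "1 / 2 * \<alpha> j * (a + b)"] \<alpha>_pos[OF assms(1)] by (simp add: abs_mult)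
    also have "\<bar>(a + b) / 2\<bar> \<le> R" using assms(2,3) by (auto simp: abs_le_iff)
    finally show ?thesis using \<alpha>_pos[OF assms(1)] by simp
  qed
  have "drift i j a - drift i j b = \<kappa> i * (1 - 1 / 2 * \<alpha> j * (a + b)) * (a - b)"
    by (simp add: drift_def field_simps power2_eq_square)
  then have "\<bar>drift i j a - drift i j b\<bar> = \<kappa> i * \<bar>1 - 1 / 2 * \<alpha> j * (a + b)\<bar> * \<bar>a - b\<bar>"
    using \<kappa>_nonneg[of i] by (simp add: abs_mult)
  also have "\<dots> \<le> \<kappa> i * (1 + \<alpha> j * R) * \<bar>a - b\<bar>"
    by (intro mult_right_mono mult_left_mono * \<kappa>_nonneg) auto
  finally show ?thesis .
qed

text \<open>Each summand is the value \<open>r i\<close> of the drift at \<open>a = 0\<close> plus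
  its Lipschitz constant on \<open>[0, 1 / m]\<close> times \<open>1 / m\<close>. The sum of these
  nonnegative terms serves as a common upper bound.\<close>

definition B :: real where
  "B = (\<Sum>i\<in>S. \<Sum>j\<in>S. \<kappa> i * (1 + \<alpha> j / m) / m + r i)"

lemma drift_avg_le_B:
  assumes "i \<in> S" "j \<in> S" "0 \<le> s"
  shows "\<bar>drift i j (avg s i U)\<bar> \<le> B"
proof -
  have nn: "0 \<le> \<kappa> i * (1 + \<alpha> j / m) / m + r i" if "i \<in> S" "j \<in> S" for i j
    using \<kappa>_nonneg[of i] \<alpha>_pos[OF that(2)] r_pos[OF that(1)] m(1) by simp
  have "\<bar>drift i j (avg s i U) - drift i j 0\<bar> \<le> \<kappa> i * (1 + \<alpha> j * (1 / m)) * \<bar>avg s i U - 0\<bar>"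
    using avg_bounds[OF assms(1,3)] m(1) by (intro drift_lipschitz assms) auto
  also have "\<dots> \<le> \<kappa> i * (1 + \<alpha> j * (1 / m)) * (1 / m)"
    using avg_bounds[OF assms(1,3)] m(1) \<alpha>_pos[OF assms(2)] \<kappa>_nonneg
    by (intro mult_left_mono mult_nonneg_nonneg) auto
  finally have "\<bar>drift i j (avg s i U)\<bar> \<le> \<kappa> i * (1 + \<alpha> j / m) / m + r i"
    using r_pos[OF assms(1)] by (simp add: drift_def)
  also have "\<dots> \<le> (\<Sum>j\<in>S. \<kappa> i * (1 + \<alpha> j / m) / m + r i)"
    by (rule member_le_sum) (use assms nn in auto)
  also have "\<dots> \<le> B" unfolding B_def
    by (rule member_le_sum[where f = "\<lambda>i. \<Sum>j\<in>S. \<kappa> i * (1 + \<alpha> j / m) / m + r i"])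
      (use assms nn in \<open>auto intro!: sum_nonneg simp del: sum.insert\<close>)
  finally show ?thesis .
qed

lemma B_nonneg: "0 \<le> B"
  using drift_avg_le_B[of 1 1 0] by fastforce

section \<open>The coupling, the a priori bound and the Lipschitz constant of the truncated
  field\<close>

lemma \<phi>_sign:
  assumes "j \<in> S"
  shows "0 \<le> x \<Longrightarrow> 0 \<le> \<phi> j x" "x \<le> 0 \<Longrightarrow> \<phi> j x \<le> 0"
  using \<alpha>_neq_1[OF assms]
  by (cases "\<alpha> j < 1"; auto simp: \<phi>_def divide_le_0_iff zero_le_divide_iff mult_le_0_iff zero_le_mult_iff)+

text \<open>The constant grows exponentially with the radius \<open>R\<close>; this is why the
  argument of \<open>\<phi> j\<close> gets truncated. The factor \<open>1 - \<alpha> j\<close> may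
  have either sign.\<close>

lemma \<phi>_lipschitz:
  assumes "j \<in> S" "\<bar>x\<bar> \<le> R" "\<bar>y\<bar> \<le> R"
  shows "\<bar>\<phi> j x - \<phi> j y\<bar> \<le> 2 * exp (\<bar>1 - \<alpha> j\<bar> * R) * \<bar>x - y\<bar>"
proof -
  define c where "c = 1 - \<alpha> j"
  have "c \<noteq> 0" using \<alpha>_neq_1[OF assms(1)] by (simp add: c_def)
  have le: "c * z \<le> \<bar>c\<bar> * R" if "\<bar>z\<bar> \<le> R" for z
    using mult_left_mono[OF that, of "\<bar>c\<bar>"] abs_ge_self[of "c * z"] by (simp add: abs_mult)
  have "\<bar>exp (c * x) - exp (c * y)\<bar> \<le> \<bar>c * x - c * y\<bar> * (exp (c * x) + exp (c * y))"
    by (rule abs_exp_diff_le)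
  also have "\<dots> \<le> \<bar>c * x - c * y\<bar> * (exp (\<bar>c\<bar> * R) + exp (\<bar>c\<bar> * R))"
    using le assms by (intro mult_left_mono add_mono) auto
  also have "\<dots> = \<bar>c\<bar> * (2 * exp (\<bar>c\<bar> * R) * \<bar>x - y\<bar>)"
    by (simp add: abs_mult flip: right_diff_distrib)
  finally have "\<bar>exp (c * x) - exp (c * y)\<bar> / \<bar>c\<bar> \<le> 2 * exp (\<bar>c\<bar> * R) * \<bar>x - y\<bar>"
    using \<open>c \<noteq> 0\<close> by (simp add: field_simps)
  then show ?thesis
    by (simp add: \<phi>_def flip: c_def diff_divide_distrib)
qed

text \<open>Only the signs of \<open>c\<close> matter, so the bound covers both the original system,
  with \<open>c\<close> the identity, and the truncated one.\<close>

lemma difference_bound: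
  assumes sign: "\<And>s x. 0 \<le> s \<Longrightarrow> 0 \<le> x \<Longrightarrow> 0 \<le> c s x" "\<And>s x. 0 \<le> s \<Longrightarrow> x \<le> 0 \<Longrightarrow> c s x \<le> 0"
    and U0: "\<And>i j. i \<in> S \<Longrightarrow> j \<in> S \<Longrightarrow> U i j 0 = 0"
    and U: "\<And>i j s. i \<in> S \<Longrightarrow> j \<in> S \<Longrightarrow> 0 \<le> s \<Longrightarrow>
      (U i j has_real_derivative field (c s) s (\<lambda>i j. U i j s) i j) (at s within {0..})"
    and "i \<in> S" "j \<in> S" "0 \<le> t"
  shows "\<bar>U (3 - i) j t - U i j t\<bar> \<le> 2 * B * t"
proof -
  have *: "U k j t - U (3 - k) j t \<le> 2 * B * t" if k: "k \<in> S" for k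
  proof (rule le_linear_if_deriv_le[where D = "\<lambda>s. U k j s - U (3 - k) j s"])
    note k' = S_other[OF k]
    show "((\<lambda>s. U k j s - U (3 - k) j s) has_real_derivative
      field (c s) s (\<lambda>i j. U i j s) k j - field (c s) s (\<lambda>i j. U i j s) (3 - k) j) (at s within {0..})"
      if "0 \<le> s" for s
      by (intro DERIV_diff U that k k' \<open>j \<in> S\<close>)
    \<comment> \<open>Above the line \<open>2 * B * s\<close> the difference is nonnegative, so the
      coupling can only lower the first component and raise the second. The two drifts contribute at
      most \<open>B\<close> each to its derivative.\<close>
    fix s assume s: "0 \<le> s" "2 * B * s < U k j s - U (3 - k) j s"
    have "0 \<le> 2 * B * s" using s B_nonneg by simp
    with s(2) have "0 \<le> U k j s - U (3 - k) j s" "U (3 - k) j s - U k j s \<le> 0" by linarith+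
    then have "c s (U (3 - k) j s - U k j s) \<le> 0" "0 \<le> c s (U k j s - U (3 - k) j s)"
      using sign s(1) by blast+
    then have "lam k * \<phi> j (c s (U (3 - k) j s - U k j s)) \<le> 0"
        "0 \<le> lam (3 - k) * \<phi> j (c s (U k j s - U (3 - k) j s))"
      using \<phi>_sign[OF \<open>j \<in> S\<close>] lam_nonneg[OF k] lam_nonneg[OF k'(1)]
      by (simp_all add: mult_nonneg_nonpos)
    moreover have "\<bar>drift i j (avg s i (\<lambda>j. U i j s))\<bar> \<le> B" if "i \<in> S" for i
      by (rule drift_avg_le_B) (use that s \<open>j \<in> S\<close> in auto)
    from this[OF k] this[OF k'(1)]
    have "drift k j (avg s k (\<lambda>j. U k j s)) - drift (3 - k) j (avg s (3 - k) (\<lambda>j. U (3 - k) j s)) \<le> 2 * B"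
      by linarith
    ultimately show "field (c s) s (\<lambda>i j. U i j s) k j - field (c s) s (\<lambda>i j. U i j s) (3 - k) j \<le> 2 * B"
      unfolding field_def k'(2) by linarith
  qed (use U0 that S_other \<open>j \<in> S\<close> \<open>0 \<le> t\<close> in auto)
  show ?thesis
    using *[OF \<open>i \<in> S\<close>] *[OF S_other(1), OF \<open>i \<in> S\<close>] S_other(2)[OF \<open>i \<in> S\<close>] by auto
qed

text \<open>The first summand composes the Lipschitz constants of \<open>drift\<close> and
  \<open>avg\<close>. In the second, the 4 is the 2 from \<open>\<phi>_lipschitz\<close> times the 2
  from a difference of two components, and \<open>2 * B * b\<close> is the largest truncation level
  up to time \<open>b\<close>.\<close>

definition L :: "real \<Rightarrow> nat \<Rightarrow> nat \<Rightarrow> real" where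
  "L b i j = \<kappa> i * (1 + \<alpha> j * (1 / m)) * (\<bar>\<alpha> 2 - \<alpha> 1\<bar> / m\<^sup>2 * 2) + lam i * (4 * exp (\<bar>1 - \<alpha> j\<bar> * (2 * B * b)))"

lemma field_lipschitz:
  assumes ij: "i \<in> S" "j \<in> S" and s: "0 \<le> s" "s \<le> b"
    and d: "\<And>i j. i \<in> S \<Longrightarrow> j \<in> S \<Longrightarrow> \<bar>U i j - V i j\<bar> \<le> d"
  shows "\<bar>field (trunc (2 * B * s)) s U i j - field (trunc (2 * B * s)) s V i j\<bar> \<le> L b i j * d"
proof -
  note ij' = S_other(1)[OF ij(1)]
  have "\<bar>drift i j (avg s i (U i)) - drift i j (avg s i (V i))\<bar>
    \<le> \<kappa> i * (1 + \<alpha> j * (1 / m)) * \<bar>avg s i (U i) - avg s i (V i)\<bar>"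
    using avg_bounds[OF ij(1) s(1)] by (intro drift_lipschitz ij) auto
  also have "\<dots> \<le> \<kappa> i * (1 + \<alpha> j * (1 / m)) * (\<bar>\<alpha> 2 - \<alpha> 1\<bar> / m\<^sup>2 * (2 * d))"
  proof (intro mult_left_mono order_trans[OF avg_lipschitz])
    show "\<bar>U i 1 - V i 1\<bar> + \<bar>U i 2 - V i 2\<bar> \<le> 2 * d"
      using d[OF ij(1), of 1] d[OF ij(1), of 2] by simp
  qed (use ij s m \<kappa>_nonneg \<alpha>_pos[OF ij(2)] in \<open>auto intro!: mult_nonneg_nonneg\<close>)
  finally have 1: "\<bar>drift i j (avg s i (U i)) - drift i j (avg s i (V i))\<bar> \<le>
    \<kappa> i * (1 + \<alpha> j * (1 / m)) * (\<bar>\<alpha> 2 - \<alpha> 1\<bar> / m\<^sup>2 * 2) * d" by (simp add: mult_ac)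
  define R where "R = 2 * B * s"
  have R: "0 \<le> R" "R \<le> 2 * B * b" using s B_nonneg by (auto simp: R_def intro: mult_left_mono)
  define x y where "x = U (3 - i) j - U i j" and "y = V (3 - i) j - V i j"
  have xy: "\<bar>x - y\<bar> \<le> 2 * d"
    using d[OF ij] d[OF ij' ij(2)] by (auto simp: x_def y_def)
  have "\<bar>\<phi> j (trunc R x) - \<phi> j (trunc R y)\<bar>
    \<le> 2 * exp (\<bar>1 - \<alpha> j\<bar> * R) * \<bar>trunc R x - trunc R y\<bar>"
    by (intro \<phi>_lipschitz ij abs_trunc_le R)
  also have "\<dots> \<le> 2 * exp (\<bar>1 - \<alpha> j\<bar> * (2 * B * b)) * (2 * d)"
    using R trunc_lipschitz[of R x y] xy by (intro mult_mono) (auto intro: mult_left_mono)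
  finally have "lam i * \<bar>\<phi> j (trunc R x) - \<phi> j (trunc R y)\<bar>
      \<le> lam i * (2 * exp (\<bar>1 - \<alpha> j\<bar> * (2 * B * b)) * (2 * d))"
    by (rule mult_left_mono[OF _ lam_nonneg[OF ij(1)]])
  then have 2: "\<bar>lam i * \<phi> j (trunc R x) - lam i * \<phi> j (trunc R y)\<bar>
      \<le> lam i * (4 * exp (\<bar>1 - \<alpha> j\<bar> * (2 * B * b))) * d"
    using lam_nonneg[OF ij(1)] by (simp add: abs_mult flip: right_diff_distrib)
  show ?thesis
    using 1 2 unfolding field_def L_def R_def x_def y_def distrib_right by linarith
qed

end

section \<open>The truncated system\<close>

lemma has_vector_derivative_vec_lambda:
  fixes f :: "real \<Rightarrow> 'n::finite \<Rightarrow> real"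
  assumes "\<And>k. ((\<lambda>s. f s k) has_real_derivative f' k) (at s within X)"
  shows "((\<lambda>s. \<chi> k. f s k) has_vector_derivative (\<chi> k. f' k)) (at s within X)"
  unfolding has_vector_derivative_def has_derivative_within
proof (intro conjI bounded_linear_scaleR_left vec_tendstoI)
  fix k
  have "((\<lambda>y. (1 / \<bar>y - s\<bar>) * (f y k - (f s k + (y - s) * f' k))) \<longlongrightarrow> 0) (at s within X)"
    using assms[of k] by (simp add: has_real_derivative_iff_has_vector_derivative has_vector_derivative_def has_derivative_within)
  then show "((\<lambda>y. ((1 / norm (y - s)) *\<^sub>R ((\<chi> k. f y k) - ((\<chi> k. f s k) + (y - s) *\<^sub>R (\<chi> k. f' k)))) $ k) \<longlongrightarrow> 0 $ k) (at s within X)"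
    by simp
qed

context ode_system
begin

text \<open>The state space is \<open>real ^ (bool \<times> bool)\<close>, with \<open>True\<close> standing for the index 1 and \<open>False\<close> for 2.\<close>

definition idx :: "bool \<Rightarrow> nat" where
  "idx b = (if b then 1 else 2)"

lemma idx: "idx b \<in> S" "i \<in> S \<Longrightarrow> idx (i = 1) = i" "(idx b = 1) = b"
  by (auto simp: idx_def)

text \<open>On \<open>S\<close> the test \<open>i = 1\<close> inverts \<open>idx\<close>, so
  \<open>x $ (i = 1, j = 1)\<close> reads a state vector as a family indexed by numbers.\<close>

definition vfield :: "real \<Rightarrow> real ^ (bool \<times> bool) \<Rightarrow> real ^ (bool \<times> bool)" where
  "vfield s x = (\<chi> k. field (trunc (2 * B * s)) s (\<lambda>i j. x $ (i = 1, j = 1)) (idx (fst k)) (idx (snd k)))"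

lemma vfield_lipschitz:
  assumes "0 \<le> s" "s \<le> b"
  shows "norm (vfield s x - vfield s y) \<le> (\<Sum>k\<in>UNIV. L b (idx (fst k)) (idx (snd k))) * norm (x - y)"
proof -
  have "norm (vfield s x - vfield s y) \<le> (\<Sum>k\<in>UNIV. \<bar>(vfield s x - vfield s y) $ k\<bar>)"
    by (rule norm_le_l1_cart)
  also have "\<dots> \<le> (\<Sum>k\<in>UNIV. L b (idx (fst k)) (idx (snd k)) * norm (x - y))"
  proof (rule sum_mono)
    fix k
    show "\<bar>(vfield s x - vfield s y) $ k\<bar> \<le> L b (idx (fst k)) (idx (snd k)) * norm (x - y)"
      unfolding vfield_def vector_minus_component vec_lambda_beta
    proof (intro field_lipschitz idx assms)
      show "\<bar>x $ (i = 1, j = 1) - y $ (i = 1, j = 1)\<bar> \<le> norm (x - y)" for i j :: nat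
        using component_le_norm_cart[of "x - y" "(i = 1, j = 1)"] by simp
    qed
  qed
  finally show ?thesis by (simp add: sum_distrib_right)
qed

lemma continuous_on_field:
  assumes "i \<in> S" "j \<in> S" and s: "continuous_on X s" "\<And>x. x \<in> X \<Longrightarrow> 0 \<le> s x"
    and U: "\<And>i j. continuous_on X (\<lambda>x. U x i j)"
  shows "continuous_on X (\<lambda>x. field (trunc (2 * B * s x)) (s x) (U x) i j)"
proof -
  \<comment> \<open>The only possible obstruction to continuity is the denominator of
    \<open>avg\<close>, which is at least \<open>m\<close> times a positive sum.\<close>
  have "0 < \<alpha> 1 * (p T lam (T - s x) i 1 * exp (U x i 1)) + \<alpha> 2 * (p T lam (T - s x) i 2 * exp (U x i 2))" if "x \<in> X" for x
  proof (rule less_le_trans[OF _ mix_ratio_denom_ge[OF m(2,3)]])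
    show "0 < m * (p T lam (T - s x) i 1 * exp (U x i 1) + p T lam (T - s x) i 2 * exp (U x i 2))"
      using that s assms by (intro mult_pos_pos m p_exp_sum_pos) auto
  qed (use p_weights[OF \<open>i \<in> S\<close> s(2)[OF that]] in auto)
  then have "continuous_on X (\<lambda>x. avg (s x) i (U x i))"
    unfolding avg_def mix_ratio_def by (intro continuous_intros s U) fastforce
  moreover have "1 - \<alpha> j \<noteq> 0" using \<alpha>_neq_1[OF \<open>j \<in> S\<close>] by simp
  ultimately show ?thesis
    unfolding field_def drift_def \<phi>_def trunc_def
    by (auto intro!: continuous_intros s U)
qed

lemma vfield_continuous: "continuous_on ({0..} \<times> UNIV) (\<lambda>(s, x). vfield s x)"
  unfolding vfield_def case_prod_unfold
  by (intro continuous_on_vec_lambda continuous_on_field idx continuous_intros) auto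

lemma vfield_component:
  assumes "i \<in> S" "j \<in> S"
  shows "vfield s x $ (i = 1, j = 1) = field (trunc (2 * B * s)) s (\<lambda>i j. x $ (i = 1, j = 1)) i j"
  using assms by (simp add: vfield_def idx del: One_nat_def)

section \<open>Passage between the original and the truncated system\<close>

lemma \<beta>: 
  assumes "j \<in> S"
  shows "\<beta> j \<noteq> 0" "(1 - \<alpha> j) * \<beta> j = \<alpha> j"
  using \<alpha>_pos[OF assms] \<alpha>_neq_1[OF assms] by (auto simp: \<beta>_def)

text \<open>With \<open>s = T - t\<close>, the function
  \<open>\<beta> j * ln (g i j (T - s))\<close> has derivative \<open>- \<beta> j\<close> times the
  logarithmic derivative of \<open>g i j\<close>. By this identity the equation for \<open>g\<close>
  therefore says that the logarithmic variables follow the untruncated field.\<close>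

lemma ode_rhs_eq:
  assumes ij: "i \<in> S" "j \<in> S" and g: "\<And>i j. i \<in> S \<Longrightarrow> j \<in> S \<Longrightarrow> 0 < g i j t"
  shows "ode_rhs T \<alpha> lam r \<mu> \<sigma> g i j t
    = - field (\<lambda>x. x) (T - t) (\<lambda>i j. \<beta> j * ln (g i j t)) i j * g i j t"
proof -
  define u where "u = (\<lambda>i j. \<beta> j * ln (g i j t))"
  note ij' = S_other(1)[OF ij(1)]
  have "g i k t powr (\<alpha> k / (1 - \<alpha> k)) = exp (u i k)" if "k \<in> S" for k
    using g[OF ij(1) that] by (simp add: powr_def u_def \<beta>_def)
  from this[of 1] this[of 2] have A: "A T \<alpha> lam g i t = avg (T - t) i (u i)"
    by (simp add: A_def avg_def mix_ratio_def mult.assoc)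
  have "(g (3 - i) j t / g i j t) powr \<alpha> j = exp (\<alpha> j * (ln (g (3 - i) j t) - ln (g i j t)))"
    using g[OF ij] g[OF ij' ij(2)] by (simp add: powr_def ln_div)
  also have "\<alpha> j * (ln (g (3 - i) j t) - ln (g i j t)) = (1 - \<alpha> j) * \<beta> j * (ln (g (3 - i) j t) - ln (g i j t))"
    by (simp only: \<beta>(2)[OF ij(2)])
  also have "\<dots> = (1 - \<alpha> j) * (u (3 - i) j - u i j)"
    by (simp add: u_def algebra_simps)
  finally have "lam i / (1 - \<alpha> j) * (1 - (g (3 - i) j t / g i j t) powr \<alpha> j) = - (lam i * \<phi> j (u (3 - i) j - u i j))"
    using \<alpha>_neq_1[OF ij(2)] by (simp add: \<phi>_def field_simps)
  then show ?thesis
    unfolding ode_rhs_def A field_def drift_def u_def[symmetric] \<kappa>_def[symmetric] by simp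
qed

lemma image_reflect: "(\<lambda>s. T - s) ` {0..} = {..T}" "(\<lambda>s. T - s) ` {..T} = {0..}"
  by (auto simp: image_iff intro: bexI[where x = "T - _"])

text \<open>The differences along a solution of the truncated system never exceed the truncation
  level, so that solution also solves the untruncated system.\<close>

lemma truncated_difference_bound:
  assumes "u 0 = 0" and u: "\<And>s. 0 \<le> s \<Longrightarrow> (u has_vector_derivative vfield s (u s)) (at s within {0..})"
    and "i \<in> S" "j \<in> S" "0 \<le> s"
  shows "\<bar>u s $ (3 - i = 1, j = 1) - u s $ (i = 1, j = 1)\<bar> \<le> 2 * B * s"
proof (rule difference_bound[where c = "\<lambda>s. trunc (2 * B * s)" and U = "\<lambda>i j s. u s $ (i = 1, j = 1)"])
  fix s x :: real assume "0 \<le> s"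
  then have "0 \<le> 2 * B * s" using B_nonneg by simp
  then show "0 \<le> x \<Longrightarrow> 0 \<le> trunc (2 * B * s) x" "x \<le> 0 \<Longrightarrow> trunc (2 * B * s) x \<le> 0"
    by (auto simp: trunc_def)
next
  fix i j s assume "i \<in> S" "j \<in> S" "0 \<le> (s::real)"
  then show "((\<lambda>s. u s $ (i = 1, j = 1)) has_real_derivative
      field (trunc (2 * B * s)) s (\<lambda>i j. u s $ (i = 1, j = 1)) i j) (at s within {0..})"
    using bounded_linear.has_vector_derivative[OF bounded_linear_vec_nth u, of s "(i = 1, j = 1)"]
    by (simp add: has_real_derivative_iff_has_vector_derivative vfield_component del: One_nat_def)
qed (use assms in auto)

text \<open>The uniqueness half: an arbitrary solution becomes a solution of one fixed Lipschitz
  initial value problem.\<close>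

lemma solution_imp_truncated:
  assumes h: "is_solution_on {..T} T \<alpha> lam r \<mu> \<sigma> h"
    and u_def: "u = (\<lambda>s. \<chi> k. \<beta> (idx (snd k)) * ln (h (idx (fst k)) (idx (snd k)) (T - s)))"
  shows "u 0 = 0" "0 \<le> s \<Longrightarrow> (u has_vector_derivative vfield s (u s)) (at s within {0..})"
proof -
  have h1: "h i j T = 1" and h_pos: "t \<le> T \<Longrightarrow> 0 < h i j t" if "i \<in> S" "j \<in> S" for i j t
    using h that unfolding is_solution_on_def by auto
  show "u 0 = 0" by (simp add: u_def vec_eq_iff h1[OF idx(1) idx(1)])
  define U where "U = (\<lambda>i j s. \<beta> j * ln (h i j (T - s)))"
  have U: "(U i j has_real_derivative field (\<lambda>x. x) s (\<lambda>i j. U i j s) i j) (at s within {0..})"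
    if ij: "i \<in> S" "j \<in> S" and s: "0 \<le> s" for i j s
  proof -
    obtain d where d: "(h i j has_real_derivative d) (at (T - s) within {..T})"
      and eq: "\<beta> j * d = ode_rhs T \<alpha> lam r \<mu> \<sigma> h i j (T - s)"
      using h ij s unfolding is_solution_on_def \<beta>_def by fastforce
    have "(h i j \<circ> (\<lambda>s. T - s) has_real_derivative d * (- 1)) (at s within {0..})"
      by (rule DERIV_image_chain) (use d in \<open>auto simp: image_reflect intro!: derivative_eq_intros\<close>)
    then have "(U i j has_real_derivative \<beta> j * (- d / h i j (T - s))) (at s within {0..})"
      unfolding U_def using h_pos[OF ij, of "T - s"] s
      by (auto intro!: derivative_eq_intros simp: o_def)
    also have "\<beta> j * (- d / h i j (T - s)) = field (\<lambda>x. x) s (\<lambda>i j. U i j s) i j"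
      using eq ode_rhs_eq[OF ij, of h "T - s"] h_pos[OF ij, of "T - s"] h_pos[of _ _ "T - s"] s
      by (simp add: U_def field_simps)
    finally show ?thesis .
  qed
  assume s: "0 \<le> s"
  have bound: "\<bar>U (3 - i) j s - U i j s\<bar> \<le> 2 * B * s" if "i \<in> S" "j \<in> S" for i j
    by (rule difference_bound[where c = "\<lambda>s x. x"]) (use that s U h1 in \<open>auto simp: U_def\<close>)
  have component: "u s $ (i = 1, j = 1) = U i j s" if "i \<in> S" "j \<in> S" for i j
    using that by (simp add: u_def U_def idx del: One_nat_def)
  have field_eq: "field (\<lambda>x. x) s (\<lambda>i j. U i j s) i j = vfield s (u s) $ (i = 1, j = 1)"
    if ij: "i \<in> S" "j \<in> S" for i j
  proof -
    \<comment> \<open>The two families agree only for indices in \<open>S\<close>, but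
      \<open>avg\<close> evaluates them only at 1 and 2.\<close>
    have "avg s i (\<lambda>j. u s $ (i = 1, j = 1)) = avg s i (\<lambda>j. U i j s)"
      using component[OF ij(1), of 1] component[OF ij(1), of 2] by (simp add: avg_def)
    then show ?thesis
      unfolding vfield_component[OF ij] field_def component[OF ij] component[OF S_other(1)[OF ij(1)] ij(2)]
      by (simp add: trunc_eq[OF bound[OF ij]])
  qed
  have "((\<lambda>s. \<chi> k. U (idx (fst k)) (idx (snd k)) s) has_vector_derivative (\<chi> k. vfield s (u s) $ k)) (at s within {0..})"
  proof (rule has_vector_derivative_vec_lambda)
    fix k :: "bool \<times> bool"
    show "(U (idx (fst k)) (idx (snd k)) has_real_derivative vfield s (u s) $ k) (at s within {0..})"
      using U[OF idx(1) idx(1) s, of "fst k" "snd k"] field_eq[OF idx(1) idx(1), of "fst k" "snd k"]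
      by (simp add: idx del: One_nat_def)
  qed
  then show "(u has_vector_derivative vfield s (u s)) (at s within {0..})"
    by (simp add: U_def u_def)
qed

lemma truncated_imp_solution:
  assumes "u 0 = 0" and u: "\<And>s. 0 \<le> s \<Longrightarrow> (u has_vector_derivative vfield s (u s)) (at s within {0..})"
    and g_def: "g = (\<lambda>i j t. exp (u (T - t) $ (i = 1, j = 1) / \<beta> j))"
  shows "is_solution_on {..T} T \<alpha> lam r \<mu> \<sigma> g"
    and "i \<in> S \<Longrightarrow> j \<in> S \<Longrightarrow> C1_within (g i j) {..T}"
proof -
  \<comment> \<open>The derivative is expressed through \<open>vfield\<close> along
    \<open>u\<close>, whose continuity then gives that of \<open>g'\<close>.\<close>
  define g' where "g' = (\<lambda>i j t. g i j t * (- vfield (T - t) (u (T - t)) $ (i = 1, j = 1) / \<beta> j))"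
  have g': "(g i j has_real_derivative g' i j t) (at t within {..T})"
    if ij: "i \<in> S" "j \<in> S" and t: "t \<le> T" for i j t
  proof -
    have "((\<lambda>s. u s $ (i = 1, j = 1)) has_real_derivative vfield (T - t) (u (T - t)) $ (i = 1, j = 1)) (at (T - t) within {0..})"
      using bounded_linear.has_vector_derivative[OF bounded_linear_vec_nth u, of "T - t" "(i = 1, j = 1)"] t
      by (simp add: has_real_derivative_iff_has_vector_derivative)
    then have "((\<lambda>s. u s $ (i = 1, j = 1)) \<circ> (\<lambda>t. T - t) has_real_derivative
        vfield (T - t) (u (T - t)) $ (i = 1, j = 1) * (- 1)) (at t within {..T})"
      by (intro DERIV_image_chain) (auto simp: image_reflect intro!: derivative_eq_intros)
    then show ?thesis
      unfolding g_def g'_def using \<beta>(1)[OF ij(2)]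
      by (auto intro!: derivative_eq_intros simp: o_def)
  qed
  have "\<beta> j * g' i j t = ode_rhs T \<alpha> lam r \<mu> \<sigma> g i j t"
    if ij: "i \<in> S" "j \<in> S" and t: "t \<le> T" for i j t
  proof -
    have "\<bar>u (T - t) $ (3 - i = 1, j = 1) - u (T - t) $ (i = 1, j = 1)\<bar> \<le> 2 * B * (T - t)"
      by (rule truncated_difference_bound) (use assms(1) u ij t in auto)
    then have "field (\<lambda>x. x) (T - t) (\<lambda>i j. \<beta> j * ln (g i j t)) i j = vfield (T - t) (u (T - t)) $ (i = 1, j = 1)"
      using \<beta>(1)[of 1] \<beta>(1)[of 2] ij
      by (auto simp: vfield_component field_def trunc_eq g_def avg_def simp del: One_nat_def)
    then show ?thesis
      using \<beta>(1)[OF ij(2)] by (simp add: ode_rhs_eq[OF ij] g_def g'_def)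
  qed
  then have "\<exists>d. (g i j has_real_derivative d) (at t within {..T}) \<and> \<beta> j * d = ode_rhs T \<alpha> lam r \<mu> \<sigma> g i j t"
    if "i \<in> S" "j \<in> S" "t \<le> T" for i j t
    using g' that by blast
  moreover have "g i j t > 0" "g i j T = 1" for i j t
    using assms(1) by (simp_all add: g_def)
  ultimately show "is_solution_on {..T} T \<alpha> lam r \<mu> \<sigma> g"
    unfolding is_solution_on_def \<beta>_def[symmetric] by simp
  have u_cont: "continuous_on {0..} u"
    using u by (auto intro!: has_vector_derivative_continuous simp: continuous_on_eq_continuous_within)
  have "continuous_on {0..} (\<lambda>s. case (s, u s) of (s, x) \<Rightarrow> vfield s x)"
    by (rule continuous_on_compose2[OF vfield_continuous]) (auto intro!: continuous_intros u_cont)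
  then have "continuous_on {0..} (\<lambda>s. vfield s (u s))" by simp
  then have "continuous_on {..T} (\<lambda>t. vfield (T - t) (u (T - t)))"
    by (rule continuous_on_compose2) (auto intro!: continuous_intros)
  moreover have "continuous_on {..T} (g i j)" if "i \<in> S" "j \<in> S"
    using DERIV_continuous_on[OF g'[OF that]] by simp
  ultimately have "continuous_on {..T} (g' i j)" if "i \<in> S" "j \<in> S"
    unfolding g'_def using that \<beta>(1) by (intro continuous_intros) auto
  then show "i \<in> S \<Longrightarrow> j \<in> S \<Longrightarrow> C1_within (g i j) {..T}"
    unfolding C1_within_def using g' by blast
qed

end

theorem theorem4p2:
  fixes T :: real and \<alpha> lam r \<mu> \<sigma> :: "nat \<Rightarrow> real"
  assumes "T > 0"
    and "\<And>j. j \<in> S \<Longrightarrow> \<alpha> j \<in> {0<..} - {1}"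
    and "\<And>i. i \<in> S \<Longrightarrow> lam i \<ge> 0"
    and "\<And>i. i \<in> S \<Longrightarrow> r i > 0"
    and "\<And>i. i \<in> S \<Longrightarrow> \<mu> i > 0"
    and "\<And>i. i \<in> S \<Longrightarrow> \<sigma> i > 0"
  shows "\<exists>g. is_solution_on {..T} T \<alpha> lam r \<mu> \<sigma> g
    \<and> (\<forall>h. is_solution_on {..T} T \<alpha> lam r \<mu> \<sigma> h \<longrightarrow>
          (\<forall>i\<in>S. \<forall>j\<in>S. \<forall>t\<in>{..T}. h i j t = g i j t))
    \<and> (\<forall>i\<in>S. \<forall>j\<in>S. C1_within (g i j) {..T} \<and> (\<forall>t\<in>{..T}. g i j t > 0))"
proof -
  have \<alpha>: "0 < \<alpha> j" "\<alpha> j \<noteq> 1" if "j \<in> S" for j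
    using assms(2)[OF that] by simp_all
  interpret ode_system T \<alpha> lam r \<mu> \<sigma>
    by unfold_locales (rule \<alpha> assms(3,4); assumption)+
  have "\<exists>u. u 0 = 0 \<and> (\<forall>s\<ge>0. (u has_vector_derivative vfield s (u s)) (at s within {0..}))"
    by (rule picard_global[OF vfield_continuous vfield_lipschitz])
  then obtain u where u: "u 0 = 0" "\<And>s. 0 \<le> s \<Longrightarrow> (u has_vector_derivative vfield s (u s)) (at s within {0..})"
    by blast
  define g where "g = (\<lambda>(i::nat) (j::nat) t. exp (u (T - t) $ (i = 1, j = 1) / \<beta> j))"
  note g = truncated_imp_solution[OF u g_def]
  have unique: "h i j t = g i j t" if h: "is_solution_on {..T} T \<alpha> lam r \<mu> \<sigma> h"
    and ij: "i \<in> S" "j \<in> S" and t: "t \<le> T" for h i j t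
  proof -
    define v where "v = (\<lambda>s. (\<chi> k. \<beta> (idx (snd k)) * ln (h (idx (fst k)) (idx (snd k)) (T - s))) :: real ^ (bool \<times> bool))"
    note v = solution_imp_truncated[OF h v_def]
    \<comment> \<open>For a single time \<open>t\<close> the interval \<open>{0..T - t}\<close>
      suffices, and on it one Lipschitz constant is valid. Both solutions start from 0.\<close>
    have "v (T - t) = u (T - t)"
    proof (rule ode_unique_Icc)
      show "norm (vfield s x - vfield s y) \<le> (\<Sum>k\<in>UNIV. L (T - t) (idx (fst k)) (idx (snd k))) * norm (x - y)"
        if "s \<in> {0..T - t}" for s x y
        using that by (intro vfield_lipschitz) auto
      show "(v has_vector_derivative vfield s (v s)) (at s within {0..T - t})" if "s \<in> {0..T - t}" for s
        by (rule has_vector_derivative_within_subset[OF v(2)]) (use that in auto)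
      show "(u has_vector_derivative vfield s (u s)) (at s within {0..T - t})" if "s \<in> {0..T - t}" for s
        by (rule has_vector_derivative_within_subset[OF u(2)]) (use that in auto)
    qed (use t u(1) v(1) in auto)
    then have "v (T - t) $ (i = 1, j = 1) = u (T - t) $ (i = 1, j = 1)" by simp
    then have "\<beta> j * ln (h i j t) = u (T - t) $ (i = 1, j = 1)"
      using ij by (simp add: v_def idx del: One_nat_def)
    then have "ln (h i j t) = u (T - t) $ (i = 1, j = 1) / \<beta> j"
      using \<beta>(1)[OF ij(2)] by (simp add: field_simps)
    moreover have "0 < h i j t" using h ij t unfolding is_solution_on_def by auto
    ultimately show ?thesis by (metis exp_ln g_def)
  qed
  show ?thesis
  proof (intro exI[of _ g] conjI allI impI ballI g)
    show "h i j t = g i j t" if "is_solution_on {..T} T \<alpha> lam r \<mu> \<sigma> h" "i \<in> S" "j \<in> S" "t \<in> {..T}" for h i j t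
      using unique[OF that(1-3)] that(4) by simp
    show "g i j t > 0" for i j t by (simp add: g_def)
  qed
qed

end
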